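(* Let $M$ be a non-degenerate canal surface in $\mathbb{R}^3$ with center curve $\alpha(s)$ and radius $r(s)$. If $M$ is a cylinder, then $M$ is a II-flat canal surface.
   Context: A canal surface is the envelope of a 1-parameter family of spheres in $\mathbb{R}^3$. The curve $\alpha : I\to\mathbb{R}^3$ of centers ($I$ an interval) is the center curve, assumed parametrized by arc length $s$, and $r:I\to(0,\infty)$, the radius, is the smooth function such that $r(s)$ is the radius of the sphere centered at $\alpha(s)$. Let $T,N,B$ be the Frenet frame of $\alpha$ (when $\alpha$ is a straight line, $T,N,B$ is a constant orthonormal frame with $T=\alpha'$). The canal surface is parametrized by $$C(s,t)=\alpha(s)-R(s)T-Q(s)\cos(t)\,N+Q(s)\sin(t)\,B,$$ where $R(s)=r(s)r'(s)$ and $Q(s)=\pm r(s)\sqrt{1-r'(s)^2}$. $E=\langle C_s,C_s\rangle$, $F=\langle C_s,C_t\rangle$, $G=\langle C_t,C_t\rangle$ are the coefficients of the first fundamental form, and $e=\langle C_{ss},n\rangle$, $f=\langle C_{st},n\rangle$, $g=\langle C_{tt},n\rangle$ those of the second, with unit normal $n=(C-\alpha)/r$ (so that $f=-F/r$, $g=-G/r$). The surface is degenerate if its first fundamental form is degenerate ($EG-F^2=0$), and non-degenerate otherwise. The second Gaussian curvature $K_{II}$ is obtained from Brioschi's formula by replacing $E,F,G$ with $e,f,g$: $$K_{II}=\frac{p-q}{(eg-f^2)^2},$$ $$p=\begin{vmatrix} -\tfrac12 e_{tt}+f_{st}-\tfrac12 g_{ss} & \tfrac12 e_s & f_s-\tfrac12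 e_t\\ f_t-\tfrac12 g_s & e & f\\ \tfrac12 g_t & f & g\end{vmatrix},\qquad q=\begin{vmatrix} 0 & \tfrac12 e_t & \tfrac12 g_s\\ \tfrac12 e_t & e & f\\ \tfrac12 g_s & f & g\end{vmatrix}.$$ A surface is II-flat if $K_{II}$ vanishes identically. A cylinder here is the canal surface with straight-line center curve and constant radius $r(s)=c\neq 0$.
   Formalization: For every cylinder eg − f² = 0, so K_II is the undefined quotient 0/0; II-flat is therefore read as: the numerator p − q vanishes identically, and the quotient is 0 under the convention x/0 = 0. *)

theory Defs
  imports "HOL-Analysis.Analysis"
begin

text \<open>
  Curves and surfaces live over an interval \<open>I\<close> that may be open, closed or half-open, so
  derivatives in the first parameter are taken within \<open>I\<close> (one-sided at an endpoint
  belonging to \<open>I\<close>). The second parameter ranges over all of \<open>\<real>\<close>.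
\<close>

definition D1 :: "real set \<Rightarrow> (real \<Rightarrow> 'a::real_normed_vector) \<Rightarrow> real \<Rightarrow> 'a"
  where "D1 I f s = vector_derivative f (at s within I)"

definition smooth_on_interval :: "real set \<Rightarrow> (real \<Rightarrow> 'a::real_normed_vector) \<Rightarrow> bool"
  where "smooth_on_interval I f \<longleftrightarrow> (\<forall>k. ((D1 I ^^ k) f) differentiable_on I)"

definition Ds :: "real set \<Rightarrow> (real \<Rightarrow> real \<Rightarrow> 'a::real_normed_vector) \<Rightarrow> real \<Rightarrow> real \<Rightarrow> 'a"
  where "Ds I X s t = D1 I (\<lambda>u. X u t) s"

definition Dt :: "(real \<Rightarrow> real \<Rightarrow> 'a::real_normed_vector) \<Rightarrow> real \<Rightarrow> real \<Rightarrow> 'a"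
  where "Dt X s t = vector_derivative (X s) (at t)"

definition straight_line :: "real set \<Rightarrow> (real \<Rightarrow> real^3) \<Rightarrow> bool"
  where "straight_line I \<alpha> \<longleftrightarrow> (\<exists>p v. \<forall>s\<in>I. \<alpha> s = p + s *\<^sub>R v)"

text \<open>
  For a straight line the frame is any constant orthonormal frame with \<open>T = \<alpha>'\<close>; its
  orientation is not prescribed. Otherwise it is the Frenet frame of a unit-speed curve, which
  requires nonvanishing curvature.
\<close>

definition frenet_frame ::
  "real set \<Rightarrow> (real \<Rightarrow> real^3) \<Rightarrow> (real \<Rightarrow> real^3) \<Rightarrow> (real \<Rightarrow> real^3) \<Rightarrow> (real \<Rightarrow> real^3) \<Rightarrow> bool"
  where "frenet_frame I \<alpha> T N B \<longleftrightarrow>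
    (\<forall>s\<in>I. T s = D1 I \<alpha> s) \<and>
    (if straight_line I \<alpha> then
       (\<exists>T0 N0 B0. (\<forall>s\<in>I. T s = T0 \<and> N s = N0 \<and> B s = B0) \<and>
          norm T0 = 1 \<and> norm N0 = 1 \<and> norm B0 = 1 \<and>
          T0 \<bullet> N0 = 0 \<and> T0 \<bullet> B0 = 0 \<and> N0 \<bullet> B0 = 0)
     else
       (\<forall>s\<in>I. D1 I T s \<noteq> 0 \<and> N s = D1 I T s /\<^sub>R norm (D1 I T s) \<and> B s = cross3 (T s) (N s)))"

text \<open>
  The sign \<open>\<epsilon>\<close> is the choice of sign in \<open>Q = \<plusminus> r \<surd>(1 - r'\<^sup>2)\<close>.
\<close>

definition canal_param ::
  "real set \<Rightarrow> (real \<Rightarrow> real^3) \<Rightarrow> (real \<Rightarrow> real) \<Rightarrow>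
   (real \<Rightarrow> real^3) \<Rightarrow> (real \<Rightarrow> real^3) \<Rightarrow> (real \<Rightarrow> real^3) \<Rightarrow> real \<Rightarrow> real \<Rightarrow> real \<Rightarrow> real^3"
  where "canal_param I \<alpha> r T N B \<epsilon> s t =
    (let R = r s * D1 I r s;
         Q = \<epsilon> * (r s * sqrt (1 - (D1 I r s)\<^sup>2))
     in \<alpha> s - R *\<^sub>R T s - (Q * cos t) *\<^sub>R N s + (Q * sin t) *\<^sub>R B s)"

text \<open>
  The bound on \<open>r'\<close> expresses that the envelope is real: the library's \<open>sqrt\<close> is also defined,
  with negative value, on negative arguments.
\<close>

definition canal_surface ::
  "real set \<Rightarrow> (real \<Rightarrow> real^3) \<Rightarrow> (real \<Rightarrow> real) \<Rightarrow>
   (real \<Rightarrow> real^3) \<Rightarrow> (real \<Rightarrow> real^3) \<Rightarrow> (real \<Rightarrow> real^3) \<Rightarrow> real \<Rightarrow> bool"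
  where "canal_surface I \<alpha> r T N B \<epsilon> \<longleftrightarrow>
    is_interval I \<and> interior I \<noteq> {} \<and>
    smooth_on_interval I \<alpha> \<and> (\<forall>s\<in>I. norm (D1 I \<alpha> s) = 1) \<and>
    smooth_on_interval I r \<and> (\<forall>s\<in>I. 0 < r s) \<and> (\<forall>s\<in>I. \<bar>D1 I r s\<bar> \<le> 1) \<and>
    frenet_frame I \<alpha> T N B \<and> \<epsilon> \<in> {1, -1}"

definition cylinder :: "real set \<Rightarrow> (real \<Rightarrow> real^3) \<Rightarrow> (real \<Rightarrow> real) \<Rightarrow> bool"
  where "cylinder I \<alpha> r \<longleftrightarrow> straight_line I \<alpha> \<and> (\<exists>c. c \<noteq> 0 \<and> (\<forall>s\<in>I. r s = c))"

definition fff_E :: "real set \<Rightarrow> (real \<Rightarrow> real \<Rightarrow> real^3) \<Rightarrow> real \<Rightarrow> real \<Rightarrow> real"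
  where "fff_E I C s t = Ds I C s t \<bullet> Ds I C s t"

definition fff_F :: "real set \<Rightarrow> (real \<Rightarrow> real \<Rightarrow> real^3) \<Rightarrow> real \<Rightarrow> real \<Rightarrow> real"
  where "fff_F I C s t = Ds I C s t \<bullet> Dt C s t"

definition fff_G :: "(real \<Rightarrow> real \<Rightarrow> real^3) \<Rightarrow> real \<Rightarrow> real \<Rightarrow> real"
  where "fff_G C s t = Dt C s t \<bullet> Dt C s t"

definition nondegenerate :: "real set \<Rightarrow> (real \<Rightarrow> real \<Rightarrow> real^3) \<Rightarrow> bool"
  where "nondegenerate I C \<longleftrightarrow>
    (\<forall>s\<in>I. \<forall>t. fff_E I C s t * fff_G C s t - (fff_F I C s t)\<^sup>2 \<noteq> 0)"

definition canal_normal ::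
  "(real \<Rightarrow> real^3) \<Rightarrow> (real \<Rightarrow> real) \<Rightarrow> (real \<Rightarrow> real \<Rightarrow> real^3) \<Rightarrow> real \<Rightarrow> real \<Rightarrow> real^3"
  where "canal_normal \<alpha> r C s t = (C s t - \<alpha> s) /\<^sub>R r s"

definition sff_e ::
  "real set \<Rightarrow> (real \<Rightarrow> real \<Rightarrow> real^3) \<Rightarrow> (real \<Rightarrow> real \<Rightarrow> real^3) \<Rightarrow> real \<Rightarrow> real \<Rightarrow> real"
  where "sff_e I C n s t = Ds I (Ds I C) s t \<bullet> n s t"

definition sff_f ::
  "real set \<Rightarrow> (real \<Rightarrow> real \<Rightarrow> real^3) \<Rightarrow> (real \<Rightarrow> real \<Rightarrow> real^3) \<Rightarrow> real \<Rightarrow> real \<Rightarrow> real"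
  where "sff_f I C n s t = Dt (Ds I C) s t \<bullet> n s t"

definition sff_g ::
  "(real \<Rightarrow> real \<Rightarrow> real^3) \<Rightarrow> (real \<Rightarrow> real \<Rightarrow> real^3) \<Rightarrow> real \<Rightarrow> real \<Rightarrow> real"
  where "sff_g C n s t = Dt (Dt C) s t \<bullet> n s t"

definition brioschi_p ::
  "real set \<Rightarrow> (real \<Rightarrow> real \<Rightarrow> real) \<Rightarrow> (real \<Rightarrow> real \<Rightarrow> real) \<Rightarrow> (real \<Rightarrow> real \<Rightarrow> real) \<Rightarrow>
   real \<Rightarrow> real \<Rightarrow> real"
  where "brioschi_p I e f g s t = det (vector
    [vector [- (1/2) * Dt (Dt e) s t + Dt (Ds I f) s t - (1/2) * Ds I (Ds I g) s t,
             (1/2) * Ds I e s t,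
             Ds I f s t - (1/2) * Dt e s t],
     vector [Dt f s t - (1/2) * Ds I g s t, e s t, f s t],
     vector [(1/2) * Dt g s t, f s t, g s t]] :: real^3^3)"

definition brioschi_q ::
  "real set \<Rightarrow> (real \<Rightarrow> real \<Rightarrow> real) \<Rightarrow> (real \<Rightarrow> real \<Rightarrow> real) \<Rightarrow> (real \<Rightarrow> real \<Rightarrow> real) \<Rightarrow>
   real \<Rightarrow> real \<Rightarrow> real"
  where "brioschi_q I e f g s t = det (vector
    [vector [0, (1/2) * Dt e s t, (1/2) * Ds I g s t],
     vector [(1/2) * Dt e s t, e s t, f s t],
     vector [(1/2) * Ds I g s t, f s t, g s t]] :: real^3^3)"

definition K_II ::
  "real set \<Rightarrow> (real \<Rightarrow> real \<Rightarrow> real^3) \<Rightarrow> (real \<Rightarrow> real \<Rightarrow> real^3) \<Rightarrow> real \<Rightarrow> real \<Rightarrow> real"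
  where "K_II I C n s t =
    (let e = sff_e I C n; f = sff_f I C n; g = sff_g C n
     in (brioschi_p I e f g s t - brioschi_q I e f g s t) /
          (e s t * g s t - (f s t)\<^sup>2)\<^sup>2)"

text \<open>
  At a point where \<open>e g - f\<^sup>2 = 0\<close> the convention \<open>x / 0 = 0\<close> would make \<open>K_II\<close> vanish whatever
  its numerator is. Vanishing of the numerator is therefore demanded as well; where
  \<open>e g - f\<^sup>2 \<noteq> 0\<close> this adds nothing.
\<close>

definition II_flat ::
  "real set \<Rightarrow> (real \<Rightarrow> real \<Rightarrow> real^3) \<Rightarrow> (real \<Rightarrow> real \<Rightarrow> real^3) \<Rightarrow> bool"
  where "II_flat I C n \<longleftrightarrow>
    (\<forall>s\<in>I. \<forall>t. K_II I C n s t = 0 \<and>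
       (let e = sff_e I C n; f = sff_f I C n; g = sff_g C n
        in brioschi_p I e f g s t - brioschi_q I e f g s t = 0))"

end

theory Submission
  imports Defs
begin

text \<open>
  Over a straight line with constant radius the parametrization has the form
  \<open>C(s,t) = p + s v + W(t)\<close>, and its normal depends on \<open>t\<close> alone. Hence \<open>C\<^sub>s\<^sub>s = C\<^sub>s\<^sub>t = 0\<close>,
  so \<open>e = f = 0\<close>, while \<open>g\<close> does not depend on \<open>s\<close>. The first row of each of the two
  Brioschi determinants involves \<open>g\<close> only through \<open>g\<^sub>s\<close> and \<open>g\<^sub>s\<^sub>s\<close>, so it is zero.
\<close>

text \<open>An interval with nonempty interior is not a single point, so each of its points,
  endpoints included, is a limit point and the derivative within \<open>I\<close> is unique.
  Agreement on \<open>I\<close> suffices, since values off \<open>I\<close> do not enter.\<close>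

lemma D1_eqI:
  fixes f :: "real \<Rightarrow> 'a::real_normed_vector"
  assumes I: "is_interval I" "interior I \<noteq> {}" and s: "s \<in> I"
    and g: "(g has_vector_derivative v) (at s within I)"
    and eq: "\<And>u. u \<in> I \<Longrightarrow> f u = g u"
  shows "D1 I f s = v"
proof -
  have "I \<noteq> {s}"
    using I(2) by auto
  then have "s islimpt I"
    using I(1) s connected_imp_perfect is_interval_connected by blast
  then have "at s within I \<noteq> bot"
    by (simp add: trivial_limit_within)
  moreover have "(f has_vector_derivative v) (at s within I)"
    using has_vector_derivative_transform[OF s eq g] by simp
  ultimately show ?thesis
    by (simp add: D1_def vector_derivative_within)
qed

lemma D1_const:
  assumes "is_interval I" "interior I \<noteq> {}" "s \<in> I" "\<And>u. u \<in> I \<Longrightarrow> f u = k"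
  shows "D1 I f s = 0"
  using D1_eqI[OF assms(1-3) has_vector_derivative_const assms(4)] .

lemma Ds_const:
  assumes "is_interval I" "interior I \<noteq> {}" "s \<in> I" "\<And>u. u \<in> I \<Longrightarrow> X u t = k"
  shows "Ds I X s t = 0"
  unfolding Ds_def using assms by (rule D1_const)

lemma Dt_const:
  assumes "\<And>t. X s t = k"
  shows "Dt X s t = 0"
proof -
  have "X s = (\<lambda>_. k)"
    using assms by auto
  then show ?thesis
    by (simp add: Dt_def)
qed

lemma brioschi_eq_0:
  assumes I: "is_interval I" "interior I \<noteq> {}" and s: "s \<in> I"
    and e: "\<And>s t. s \<in> I \<Longrightarrow> e s t = 0"
    and f: "\<And>s t. s \<in> I \<Longrightarrow> f s t = 0"
    and g: "\<And>s t. s \<in> I \<Longrightarrow> g s t = \<gamma> t"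
  shows "brioschi_p I e f g s t = 0" and "brioschi_q I e f g s t = 0"
proof -
  note Ds0 = Ds_const[OF I]
  have es: "Ds I e u t = 0" and fs: "Ds I f u t = 0" and gs: "Ds I g u t = 0"
    and et: "Dt e u t = 0" if "u \<in> I" for u t
    using that e f g by (auto intro: Ds0 Dt_const)
  \<comment> \<open>The first derivatives vanish at all points over \<open>I\<close>, not only at
    \<open>s\<close>, so they can be differentiated again.\<close>
  have "Dt (Dt e) s t = 0" "Dt (Ds I f) s t = 0" "Ds I (Ds I g) s t = 0"
    using s et fs gs by (auto intro: Ds0 Dt_const)
  then show "brioschi_p I e f g s t = 0" "brioschi_q I e f g s t = 0"
    using s es fs gs et e f by (simp_all add: brioschi_p_def brioschi_q_def det_3)
qed

text \<open>Isolates what the cylinder provides: translation of a curve \<open>W\<close> along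
  straight rulings, with a normal constant along each ruling.\<close>

lemma II_flat_translation_surface:
  assumes I: "is_interval I" "interior I \<noteq> {}"
    and C: "\<And>s t. s \<in> I \<Longrightarrow> C s t = p + s *\<^sub>R v + W t"
    and W: "\<And>t. (W has_vector_derivative W' t) (at t)"
    and n: "\<And>s t. s \<in> I \<Longrightarrow> n s t = \<nu> t"
  shows "II_flat I C n"
proof -
  have Cs: "Ds I C s t = v" if "s \<in> I" for s t
    unfolding Ds_def
    by (rule D1_eqI[OF I that _ C]) (auto intro!: derivative_eq_intros)
  have Ct: "Dt C s t = W' t" if "s \<in> I" for s t
  proof -
    have "C s = (\<lambda>t. p + s *\<^sub>R v + W t)"
      using C[OF that] by auto
    moreover have "((\<lambda>t. p + s *\<^sub>R v + W t) has_vector_derivative W' t) (at t)"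
      by (auto intro!: derivative_eq_intros W)
    ultimately show ?thesis
      by (simp add: Dt_def vector_derivative_at)
  qed
  have e: "sff_e I C n s t = 0" and f: "sff_f I C n s t = 0" if "s \<in> I" for s t
    using that by (simp_all add: sff_e_def sff_f_def Ds_const[OF I that Cs] Dt_const[OF Cs])
  have g: "sff_g C n s t = vector_derivative W' (at t) \<bullet> \<nu> t" if "s \<in> I" for s t
  proof -
    \<comment> \<open>An equality of functions of \<open>t\<close>, so the second
      \<open>t\<close>-derivative of \<open>C\<close> is that of \<open>W'\<close>, the same for
      every \<open>s\<close> in \<open>I\<close>.\<close>
    have "Dt C s = W'"
      using Ct[OF that] by auto
    then show ?thesis
      by (simp add: sff_g_def Dt_def[of "Dt C"] n[OF that])
  qed
  \<comment> \<open>Here \<open>e g - f\<^sup>2 = 0\<close>, so the quotient \<open>K_II\<close> is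
    0 by the division convention; the substance is the vanishing numerator.\<close>
  show ?thesis
    using brioschi_eq_0[OF I _ e f g] by (simp add: II_flat_def K_II_def)
qed

theorem theorem6:
  fixes I :: "real set"
    and \<alpha> T N B :: "real \<Rightarrow> real^3"
    and r :: "real \<Rightarrow> real"
    and \<epsilon> :: real
    and C :: "real \<Rightarrow> real \<Rightarrow> real^3"
  defines "C \<equiv> canal_param I \<alpha> r T N B \<epsilon>"
  assumes "canal_surface I \<alpha> r T N B \<epsilon>"
    and "nondegenerate I C"
    and "cylinder I \<alpha> r"
  shows "II_flat I C (canal_normal \<alpha> r C)"
proof -
  have I: "is_interval I" "interior I \<noteq> {}" and frame: "frenet_frame I \<alpha> T N B"
    using assms(2) by (auto simp: canal_surface_def)
  obtain c where line: "straight_line I \<alpha>" and c: "\<And>s. s \<in> I \<Longrightarrow> r s = c"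
    using assms(4) by (auto simp: cylinder_def)
  obtain p v where \<alpha>: "\<And>s. s \<in> I \<Longrightarrow> \<alpha> s = p + s *\<^sub>R v"
    using line by (auto simp: straight_line_def)
  obtain N0 B0 where NB: "\<And>s. s \<in> I \<Longrightarrow> N s = N0" "\<And>s. s \<in> I \<Longrightarrow> B s = B0"
    using frame line by (auto simp: frenet_frame_def)
  \<comment> \<open>The circular cross-section: constant radius gives \<open>r' = 0\<close>, hence
    \<open>R = 0\<close> and \<open>Q = \<epsilon> * c\<close>.\<close>
  define W where "W t = (\<epsilon> * c * sin t) *\<^sub>R B0 - (\<epsilon> * c * cos t) *\<^sub>R N0" for t
  have "D1 I r s = 0" if "s \<in> I" for s
    using D1_const[OF I that c] .
  then have C: "C s t = p + s *\<^sub>R v + W t" if "s \<in> I" for s t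
    using that by (simp add: C_def canal_param_def W_def \<alpha> c NB mult.assoc)
  have W: "(W has_vector_derivative
      (\<epsilon> * c * cos t) *\<^sub>R B0 + (\<epsilon> * c * sin t) *\<^sub>R N0) (at t)" for t
    unfolding W_def by (auto intro!: derivative_eq_intros simp: mult_ac)
  have n: "canal_normal \<alpha> r C s t = W t /\<^sub>R c" if "s \<in> I" for s t
    using that by (simp add: canal_normal_def C \<alpha> c)
  show ?thesis
    using II_flat_translation_surface[OF I C W n] .
qed

end
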